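(* For every positive integer $k$, $$RR(\mathcal{E}(k,4)) = \begin{cases} 3 & \text{if } k \in\{2,3,4\},\\ 5 & \text{if } k \in\{6,7,8,10,11,14\},\\ 6 & \text{if } k\in\{5,9,12,13,15,18\},\\ 8 & \text{if } k\in\{17,19,22\},\\ 9 & \text{if } k\in\{1,23,24\},\\ 10 & \text{if } k\in\{16,20,21\} \text{ or } k \geq 25.\end{cases}$$
   Context: For a positive integer $k$ and an integer $j > -k$, $\mathcal{E}(k,j)$ denotes the equation $x+y+kz=(k+j)w$. A $2$-coloring of $[1,N]=\{1,2,\dots,N\}$ is a map $\chi:[1,N]\to\{0,1\}$; a solution $(x,y,z,w)$ with $x,y,z,w\in[1,N]$ (not necessarily distinct) is monochromatic if $\chi(x)=\chi(y)=\chi(z)=\chi(w)$. For an equation $\mathcal{E}$, $RR(\mathcal{E})$ denotes the minimum positive integer $N$ such that every $2$-coloring of $[1,N]$ admits a monochromatic solution to $\mathcal{E}$ in $[1,N]$. *)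

theory Defs
  imports Main "HOL-Library.FuncSet" "HOL-Library.Extended_Nat"
begin

text \<open>
  An equation in four positive integer unknowns is represented by its solution predicate.
\<close>

type_synonym equation = "nat \<Rightarrow> nat \<Rightarrow> nat \<Rightarrow> nat \<Rightarrow> bool"

text \<open>
  Meant for \<open>k > 0\<close> and \<open>j > - k\<close>; it is evaluated over the integers because
  \<open>j\<close> may be negative.
\<close>

definition eqn :: "nat \<Rightarrow> int \<Rightarrow> equation" where
  "eqn k j x y z w \<longleftrightarrow> int x + int y + int k * int z = (int k + j) * int w"

definition has_mono_solution :: "equation \<Rightarrow> nat \<Rightarrow> (nat \<Rightarrow> nat) \<Rightarrow> bool" where
  "has_mono_solution E N \<chi> \<longleftrightarrow>
     (\<exists>x\<in>{1..N}. \<exists>y\<in>{1..N}. \<exists>z\<in>{1..N}. \<exists>w\<in>{1..N}.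
        E x y z w \<and> \<chi> x = \<chi> y \<and> \<chi> y = \<chi> z \<and> \<chi> z = \<chi> w)"

definition two_coloring :: "nat \<Rightarrow> (nat \<Rightarrow> nat) \<Rightarrow> bool" where
  "two_coloring N \<chi> \<longleftrightarrow> \<chi> \<in> {1..N} \<rightarrow> {0, 1}"

text \<open>
  The infimum in \<^typ>\<open>enat\<close> is the minimum whenever some suitable \<open>N\<close> exists, and is
  \<open>\<infinity>\<close> otherwise, so a finite value includes the existence of the minimum.
\<close>

definition RR :: "equation \<Rightarrow> enat" where
  "RR E = Inf {enat N | N. N > 0 \<and> (\<forall>\<chi>. two_coloring N \<chi> \<longrightarrow> has_mono_solution E N \<chi>)}"

end

theory Submission
  imports Defs
begin

text \<open>
  Taking \<open>z = w\<close> turns every solution of \<open>x + y = 4 w\<close> into a solution of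
  \<open>x + y + k z = (k + 4) w\<close>, for all \<open>k\<close>. If \<open>A\<close> and \<open>B\<close> are the colour classes of a colouring
  without monochromatic solution and \<open>1 \<in> A\<close>, these solutions force successively
  \<open>2, 3 \<in> B\<close>, \<open>4, 5, 6 \<in> A\<close>, \<open>8 \<in> B\<close>, \<open>9 \<in> A\<close>, \<open>7 \<in> B\<close>, and leave no room for \<open>10\<close>.
  Hence the number is at most \<open>10\<close>, and for smaller values only these forced classes have to be
  inspected. For \<open>k \<ge> 35\<close> there are no solutions in \<open>[1, 9]\<close> other than those with \<open>z = w\<close>.
\<close>

section \<open>Solution-free sets and colourings\<close>

definition sol_free :: "nat \<Rightarrow> nat set \<Rightarrow> bool" where
  "sol_free k A \<longleftrightarrow> (\<forall>x\<in>A. \<forall>y\<in>A. \<forall>z\<in>A. \<forall>w\<in>A. x + y + k * z \<noteq> (k + 4) * w)"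

text \<open>Serves both bounds: a solution inside a forced subset rules out the whole class, and a
  good colouring restricts to shorter intervals.\<close>

lemma sol_free_mono: "sol_free k B \<Longrightarrow> A \<subseteq> B \<Longrightarrow> sol_free k A"
  unfolding sol_free_def by blast

lemma sol_freeD: "sol_free k A \<Longrightarrow> x + y = 4 * w \<Longrightarrow> x \<in> A \<Longrightarrow> y \<in> A \<Longrightarrow> w \<notin> A"
  unfolding sol_free_def by (metis add.commute add_mult_distrib)

lemma eqn_4_iff: "eqn k 4 x y z w \<longleftrightarrow> x + y + k * z = (k + 4) * w"
proof -
  have "eqn k 4 x y z w \<longleftrightarrow> int (x + y + k * z) = int ((k + 4) * w)"
    unfolding eqn_def by simp
  then show ?thesis by (simp only: of_nat_eq_iff)
qed

lemma has_mono_solution_iff: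
  assumes "two_coloring N \<chi>"
  shows "has_mono_solution (eqn k 4) N \<chi> \<longleftrightarrow>
    \<not> (sol_free k {i \<in> {1..N}. \<chi> i = 0} \<and> sol_free k {i \<in> {1..N}. \<chi> i = 1})"
proof -
  have bin: "\<chi> i = 0 \<or> \<chi> i = 1" if "i \<in> {1..N}" for i
    using assms that unfolding two_coloring_def by auto
  show ?thesis
  proof
    assume "has_mono_solution (eqn k 4) N \<chi>"
    then obtain x y z w where "x \<in> {1..N}" "y \<in> {1..N}" "z \<in> {1..N}" "w \<in> {1..N}"
      and "x + y + k * z = (k + 4) * w" and "\<chi> x = \<chi> y" "\<chi> y = \<chi> z" "\<chi> z = \<chi> w"
      unfolding has_mono_solution_def eqn_4_iff by blast
    then have "\<not> sol_free k {i \<in> {1..N}. \<chi> i = \<chi> x}" "\<chi> x = 0 \<or> \<chi> x = 1"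
      using bin[of x] unfolding sol_free_def by fastforce+
    then show "\<not> (sol_free k {i \<in> {1..N}. \<chi> i = 0} \<and> sol_free k {i \<in> {1..N}. \<chi> i = 1})"
      by auto
  next
    assume "\<not> (sol_free k {i \<in> {1..N}. \<chi> i = 0} \<and> sol_free k {i \<in> {1..N}. \<chi> i = 1})"
    then obtain c x y z w where "x \<in> {1..N}" "y \<in> {1..N}" "z \<in> {1..N}" "w \<in> {1..N}"
      and "x + y + k * z = (k + 4) * w" and "\<chi> x = c" "\<chi> y = c" "\<chi> z = c" "\<chi> w = c"
      unfolding sol_free_def by blast
    then show "has_mono_solution (eqn k 4) N \<chi>"
      unfolding has_mono_solution_def eqn_4_iff by metis
  qed
qed

text \<open>Exchanging the colours if necessary, \<open>A\<close> is the class of 1.\<close>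

lemma RR_leI:
  assumes "N > 0"
    and no_partition: "\<And>A B. A \<union> B = {1..N} \<Longrightarrow> 1 \<in> A \<Longrightarrow> sol_free k A \<Longrightarrow> sol_free k B \<Longrightarrow> False"
  shows "RR (eqn k 4) \<le> enat N"
proof -
  have "has_mono_solution (eqn k 4) N \<chi>" if \<chi>: "two_coloring N \<chi>" for \<chi>
  proof (rule ccontr)
    let ?C = "\<lambda>c. {i \<in> {1..N}. \<chi> i = c}"
    assume "\<not> has_mono_solution (eqn k 4) N \<chi>"
    then have free: "sol_free k (?C 0)" "sol_free k (?C 1)"
      using has_mono_solution_iff[OF \<chi>] by auto
    have union: "?C 0 \<union> ?C 1 = {1..N}"
      using \<chi> unfolding two_coloring_def by auto
    have "1 \<in> ?C 0 \<union> ?C 1"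
      unfolding union using \<open>N > 0\<close> by simp
    then show False
    proof (rule UnE)
      assume "1 \<in> ?C 0"
      then show False by (rule no_partition[OF union _ free])
    next
      assume "1 \<in> ?C 1"
      then show False by (rule no_partition[OF trans[OF Un_commute union] _ free(2,1)])
    qed
  qed
  with \<open>N > 0\<close> show ?thesis
    unfolding RR_def by (intro Inf_lower) auto
qed

text \<open>One good cover of [1, M] excludes every N \<le> M at once; \<open>?\<chi>\<close> gives
  the points of an overlap to \<open>A\<close>.\<close>

lemma Suc_le_RR:
  assumes "A \<union> B = {1..M}" "sol_free k A" "sol_free k B"
  shows "enat (Suc M) \<le> RR (eqn k 4)"
  unfolding RR_def
proof (rule Inf_greatest, safe)
  fix N
  assume all: "\<forall>\<chi>. two_coloring N \<chi> \<longrightarrow> has_mono_solution (eqn k 4) N \<chi>"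
  let ?\<chi> = "\<lambda>i. if i \<in> A then 0 else 1 :: nat"
  show "enat (Suc M) \<le> enat N"
  proof (rule ccontr)
    assume "\<not> enat (Suc M) \<le> enat N"
    then have "{1..N} \<subseteq> A \<union> B"
      using assms(1) by auto
    then have "sol_free k {i \<in> {1..N}. ?\<chi> i = 0}" "sol_free k {i \<in> {1..N}. ?\<chi> i = 1}"
      by (intro sol_free_mono[OF assms(2)] sol_free_mono[OF assms(3)]; auto split: if_splits)+
    moreover have "two_coloring N ?\<chi>"
      unfolding two_coloring_def by auto
    ultimately show False
      using all has_mono_solution_iff by blast
  qed
qed

section \<open>Forced colour classes\<close>

context
  fixes k N :: nat and A B :: "nat set"
  assumes part: "A \<union> B = {1..N}" "1 \<in> A" and free: "sol_free k A" "sol_free k B"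
begin

lemma cover: "0 < i \<Longrightarrow> i \<le> N \<Longrightarrow> i \<in> A \<or> i \<in> B"
  using part by (metis Suc_leI One_nat_def UnE atLeastAtMost_iff)

lemma forced_3: "3 \<le> N \<Longrightarrow> {2, 3} \<subseteq> B"
  using cover[of 2] cover[of 3] part(2) sol_freeD[OF free(1), of 2 2 1] sol_freeD[OF free(1), of 1 3 1]
  by auto

lemma forced_5: "5 \<le> N \<Longrightarrow> {1, 4, 5} \<subseteq> A"
  using cover[of 4] cover[of 5] part(2) forced_3
    sol_freeD[OF free(2), of 4 4 2] sol_freeD[OF free(2), of 3 5 2]
  by auto

lemma forced_6: "6 \<le> N \<Longrightarrow> {1, 4, 5, 6} \<subseteq> A"
  using cover[of 6] forced_3 forced_5 sol_freeD[OF free(2), of 2 6 2]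
  by auto

lemma forced_8: "8 \<le> N \<Longrightarrow> {2, 3, 8} \<subseteq> B"
  using cover[of 8] forced_3 forced_5 sol_freeD[OF free(1), of 8 8 4]
  by auto

text \<open>The place of 7 is settled only through 9, by 7 + 9 = 4 * 4; within [1, 8] the solutions
  with z = w leave it open.\<close>

lemma forced_9: "9 \<le> N \<Longrightarrow> {1, 4, 5, 6, 9} \<subseteq> A \<and> {2, 3, 7, 8} \<subseteq> B"
  using cover[of 9] cover[of 7] forced_6 forced_8
    sol_freeD[OF free(2), of 3 9 3] sol_freeD[OF free(1), of 7 9 4]
  by auto

text \<open>10 + 10 = 4 * 5 keeps 10 out of \<open>A\<close>, and 2 + 10 = 4 * 3 keeps it out of
  \<open>B\<close>.\<close>

lemma not_10_le: "\<not> 10 \<le> N"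
  using cover[of 10] forced_3 forced_5
    sol_freeD[OF free(1), of 10 10 5] sol_freeD[OF free(2), of 2 10 3]
  by auto

end

section \<open>Upper bounds from the forced classes\<close>

lemma RR_le_3:
  assumes "\<not> sol_free k {2, 3}"
  shows "RR (eqn k 4) \<le> enat 3"
proof (rule RR_leI)
  fix A B assume *: "A \<union> B = {1..3}" "1 \<in> A" "sol_free k A" "sol_free k B"
  have "{2, 3} \<subseteq> B"
    using forced_3[OF *] by simp
  then show False
    using assms sol_free_mono[OF *(4)] by metis
qed simp

lemma RR_le_5:
  assumes "\<not> (sol_free k {1, 4, 5} \<and> sol_free k {2, 3})"
  shows "RR (eqn k 4) \<le> enat 5"
proof (rule RR_leI)
  fix A B assume *: "A \<union> B = {1..5}" "1 \<in> A" "sol_free k A" "sol_free k B"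
  have "{1, 4, 5} \<subseteq> A" "{2, 3} \<subseteq> B"
    using forced_3[OF *] forced_5[OF *] by simp_all
  then show False
    using assms sol_free_mono[OF *(3)] sol_free_mono[OF *(4)] by metis
qed simp

lemma RR_le_6:
  assumes "\<not> (sol_free k {1, 4, 5, 6} \<and> sol_free k {2, 3})"
  shows "RR (eqn k 4) \<le> enat 6"
proof (rule RR_leI)
  fix A B assume *: "A \<union> B = {1..6}" "1 \<in> A" "sol_free k A" "sol_free k B"
  have "{1, 4, 5, 6} \<subseteq> A" "{2, 3} \<subseteq> B"
    using forced_3[OF *] forced_6[OF *] by simp_all
  then show False
    using assms sol_free_mono[OF *(3)] sol_free_mono[OF *(4)] by metis
qed simp

text \<open>Since 7 is not yet forced, both of its placements have to fail.\<close>

lemma RR_le_8: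
  assumes "\<not> (sol_free k {1, 4, 5, 6, 7} \<and> sol_free k {2, 3, 8})"
    and "\<not> (sol_free k {1, 4, 5, 6} \<and> sol_free k {2, 3, 7, 8})"
  shows "RR (eqn k 4) \<le> enat 8"
proof (rule RR_leI)
  fix A B assume *: "A \<union> B = {1..8}" "1 \<in> A" "sol_free k A" "sol_free k B"
  have sub: "{1, 4, 5, 6} \<subseteq> A" "{2, 3, 8} \<subseteq> B"
    using forced_6[OF *] forced_8[OF *] by simp_all
  show False
  proof (cases "7 \<in> A")
    case True
    with sub have "{1, 4, 5, 6, 7} \<subseteq> A" by simp
    then show False
      using sub assms(1) sol_free_mono[OF *(3)] sol_free_mono[OF *(4)] by metis
  next
    case False
    with sub cover[OF *, of 7] have "{2, 3, 7, 8} \<subseteq> B" by simp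
    then show False
      using sub assms(2) sol_free_mono[OF *(3)] sol_free_mono[OF *(4)] by metis
  qed
qed simp

lemma RR_le_9:
  assumes "\<not> (sol_free k {1, 4, 5, 6, 9} \<and> sol_free k {2, 3, 7, 8})"
  shows "RR (eqn k 4) \<le> enat 9"
proof (rule RR_leI)
  fix A B assume *: "A \<union> B = {1..9}" "1 \<in> A" "sol_free k A" "sol_free k B"
  have "{1, 4, 5, 6, 9} \<subseteq> A" "{2, 3, 7, 8} \<subseteq> B"
    using forced_9[OF *] by simp_all
  then show False
    using assms sol_free_mono[OF *(3)] sol_free_mono[OF *(4)] by metis
qed simp

lemma RR_le_10: "RR (eqn k 4) \<le> enat 10"
proof (rule RR_leI)
  fix A B assume *: "A \<union> B = {1..10}" "1 \<in> A" "sol_free k A" "sol_free k B"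
  show False
    using not_10_le[OF *] by simp
qed simp

section \<open>Good colourings of [1, 9]\<close>

text \<open>A solution with z \<noteq> w has k \<le> k |z - w| = |4 w - x - y|. On [1, 9] the number
  4 w - x - y lies between 4 - 18 and 36 - 2, so k \<le> 34.\<close>

lemma sol_free_large:
  assumes "k \<ge> 35" "A \<subseteq> {1..9}" "\<forall>x\<in>A. \<forall>y\<in>A. \<forall>w\<in>A. x + y \<noteq> 4 * w"
  shows "sol_free k A"
  unfolding sol_free_def
proof (intro ballI notI)
  fix x y z w
  assume in_A: "x \<in> A" "y \<in> A" "z \<in> A" "w \<in> A" and eq: "x + y + k * z = (k + 4) * w"
  have bounds: "1 \<le> x" "1 \<le> y" "1 \<le> w" "x \<le> 9" "y \<le> 9" "w \<le> 9"
    using in_A assms(2) by auto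
  have eq': "x + y + k * z = k * w + 4 * w"
    using eq by (simp add: algebra_simps)
  consider "z = w" | "w + 1 \<le> z" | "z + 1 \<le> w" by linarith
  then show False
  proof cases
    case 1
    with eq' in_A assms(3) show ?thesis by auto
  next
    case 2
    then have "k * (w + 1) \<le> k * z" by (rule mult_le_mono2)
    with eq' bounds assms(1) show ?thesis by (simp add: algebra_simps)
  next
    case 3
    then have "k * (z + 1) \<le> k * w" by (rule mult_le_mono2)
    with eq' bounds assms(1) show ?thesis by (simp add: algebra_simps)
  qed
qed

lemma sol_free_9:
  assumes "k \<in> {16, 20, 21} \<or> k \<ge> 25"
  shows "sol_free k {1, 4, 5, 6, 9} \<and> sol_free k {2, 3, 7, 8}"
proof (cases "k \<ge> 35")
  case True
  then show ?thesis
    by (intro conjI sol_free_large) simp_all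
next
  case False
  with assms have "k \<in> {16, 20, 21, 25, 26, 27, 28, 29, 30, 31, 32, 33, 34}"
    by simp presburger
  then show ?thesis
    unfolding sol_free_def by (elim insertE emptyE) simp_all
qed

section \<open>Exact values\<close>

lemma RR_eq_3:
  assumes "k \<in> {2, 3, 4}"
  shows "RR (eqn k 4) = enat 3"
proof (rule antisym)
  \<comment> \<open>Solutions with z = w + 1 are those of x + y = 4 w - k. Here w = 2 works: 8 - k
    is 6, 5 or 4, a sum of two elements of {2, 3}.\<close>
  show "RR (eqn k 4) \<le> enat 3"
    by (intro RR_le_3; insert assms; unfold sol_free_def; elim insertE emptyE; simp)
  have "sol_free k {1} \<and> sol_free k {2}"
    using assms unfolding sol_free_def by (elim insertE emptyE) simp_all
  moreover have "{1} \<union> {2} = {1..2::nat}"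
    by code_simp
  ultimately have "enat (Suc 2) \<le> RR (eqn k 4)"
    by (metis Suc_le_RR)
  then show "enat 3 \<le> RR (eqn k 4)" by simp
qed

lemma RR_eq_5:
  assumes "k \<in> {6, 7, 8, 10, 11, 14}"
  shows "RR (eqn k 4) = enat 5"
proof (rule antisym)
  \<comment> \<open>With w = 4 and z = 5, the listed k are exactly the values 16 - x - y for x, y in
    {1, 4, 5}.\<close>
  show "RR (eqn k 4) \<le> enat 5"
    by (intro RR_le_5; insert assms; unfold sol_free_def; elim insertE emptyE; simp)
  have "sol_free k {1, 4} \<and> sol_free k {2, 3}"
    using assms unfolding sol_free_def by (elim insertE emptyE) simp_all
  moreover have "{1, 4} \<union> {2, 3} = {1..4::nat}"
    by code_simp
  ultimately have "enat (Suc 4) \<le> RR (eqn k 4)"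
    by (metis Suc_le_RR)
  then show "enat 5 \<le> RR (eqn k 4)" by simp
qed

lemma RR_eq_6:
  assumes "k \<in> {5, 9, 12, 13, 15, 18}"
  shows "RR (eqn k 4) = enat 6"
proof (rule antisym)
  \<comment> \<open>For k \<noteq> 5 take w = 5, z = 6 and x + y = 20 - k; for k = 5 take w = 4, z =
    5 and 5 + 6 = 16 - k.\<close>
  show "RR (eqn k 4) \<le> enat 6"
    by (intro RR_le_6; insert assms; unfold sol_free_def; elim insertE emptyE; simp)
  have "sol_free k {1, 4, 5} \<and> sol_free k {2, 3}"
    using assms unfolding sol_free_def by (elim insertE emptyE) simp_all
  moreover have "{1, 4, 5} \<union> {2, 3} = {1..5::nat}"
    by code_simp
  ultimately have "enat (Suc 5) \<le> RR (eqn k 4)"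
    by (metis Suc_le_RR)
  then show "enat 6 \<le> RR (eqn k 4)" by simp
qed

lemma RR_eq_8:
  assumes "k \<in> {17, 19, 22}"
  shows "RR (eqn k 4) = enat 8"
proof (rule antisym)
  \<comment> \<open>If 7 joins the class of 1, take w = 6, z = 7 and x + y = 24 - k; otherwise w =
    7, z = 8 and x + y = 28 - k.\<close>
  show "RR (eqn k 4) \<le> enat 8"
    by (intro RR_le_8; insert assms; unfold sol_free_def; elim insertE emptyE; simp)
  have "sol_free k {1, 4, 5, 6} \<and> sol_free k {2, 3, 7}"
    using assms unfolding sol_free_def by (elim insertE emptyE) simp_all
  moreover have "{1, 4, 5, 6} \<union> {2, 3, 7} = {1..7::nat}"
    by code_simp
  ultimately have "enat (Suc 7) \<le> RR (eqn k 4)"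
    by (metis Suc_le_RR)
  then show "enat 8 \<le> RR (eqn k 4)" by simp
qed

lemma RR_eq_9:
  assumes "k \<in> {1, 23, 24}"
  shows "RR (eqn k 4) = enat 9"
proof (rule antisym)
  \<comment> \<open>For k = 1 use 9 + 6 + 5 = 5 * 4; for k = 23 and k = 24 use w = 7, z = 8 and x +
    y = 28 - k.\<close>
  show "RR (eqn k 4) \<le> enat 9"
    by (intro RR_le_9; insert assms; unfold sol_free_def; elim insertE emptyE; simp)
  \<comment> \<open>No single placement of 7 serves all three k: beside 4 and 6 it fails for k = 1,
    as 7 + 7 + 6 = 5 * 4, and beside 2, 3 and 8 it fails for 23 and 24 by the solutions with w = 7,
    z = 8.\<close>
  obtain A B where "sol_free k A \<and> sol_free k B" "A \<union> B = {1..8}"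
  proof (cases "k = 1")
    case True
    then have "sol_free k {1, 4, 5, 6} \<and> sol_free k {2, 3, 7, 8}"
      unfolding sol_free_def by simp
    moreover have "{1, 4, 5, 6} \<union> {2, 3, 7, 8} = {1..8::nat}"
      by code_simp
    ultimately show ?thesis by (rule that)
  next
    case False
    with assms have "k \<in> {23, 24}" by simp
    then have "sol_free k {1, 4, 5, 6, 7} \<and> sol_free k {2, 3, 8}"
      unfolding sol_free_def by (elim insertE emptyE) simp_all
    moreover have "{1, 4, 5, 6, 7} \<union> {2, 3, 8} = {1..8::nat}"
      by code_simp
    ultimately show ?thesis by (rule that)
  qed
  then have "enat (Suc 8) \<le> RR (eqn k 4)"
    by (metis Suc_le_RR)
  then show "enat 9 \<le> RR (eqn k 4)" by simp
qed

lemma RR_eq_10: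
  assumes "k \<in> {16, 20, 21} \<or> k \<ge> 25"
  shows "RR (eqn k 4) = enat 10"
proof (rule antisym[OF RR_le_10])
  have "{1, 4, 5, 6, 9} \<union> {2, 3, 7, 8} = {1..9::nat}"
    by code_simp
  with sol_free_9[OF assms] have "enat (Suc 9) \<le> RR (eqn k 4)"
    by (metis Suc_le_RR)
  then show "enat 10 \<le> RR (eqn k 4)" by simp
qed

theorem theorem6:
  fixes k :: nat
  assumes "k > 0"
  shows "(k \<in> {2, 3, 4} \<longrightarrow> RR (eqn k 4) = 3) \<and>
         (k \<in> {6, 7, 8, 10, 11, 14} \<longrightarrow> RR (eqn k 4) = 5) \<and>
         (k \<in> {5, 9, 12, 13, 15, 18} \<longrightarrow> RR (eqn k 4) = 6) \<and>
         (k \<in> {17, 19, 22} \<longrightarrow> RR (eqn k 4) = 8) \<and>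
         (k \<in> {1, 23, 24} \<longrightarrow> RR (eqn k 4) = 9) \<and>
         (k \<in> {16, 20, 21} \<or> k \<ge> 25 \<longrightarrow> RR (eqn k 4) = 10)"
  unfolding numeral_eq_enat
  by (intro conjI impI RR_eq_3 RR_eq_5 RR_eq_6 RR_eq_8 RR_eq_9 RR_eq_10)

end
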